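(* Let $v$ be a non-zero element of $\mathbb C^n$. Then the vector spaces $$\mathcal E_1(v)=\{\phi_a:\mathrm{SO}^*(2n)\to\mathbb C\ |\ \phi_a(z+jw)=\mathrm{trace}(v^taz^t),\ a\in\mathbb C^n\}$$ and $$\mathcal E_2(v)=\{\psi_c:\mathrm{SO}^*(2n)\to\mathbb C\ |\ \psi_c(z+jw)=\mathrm{trace}(v^tcw^t),\ c\in\mathbb C^n\}$$ are eigenfamilies on $\mathrm{SO}^*(2n)$ and their union $\mathcal B=\mathcal E_1(v)\cup\mathcal E_2(v)$ is a bi-eigenfamily.
   Context: Elements of $\mathbb C^n$ are row vectors, so $v^ta$ is the $n\times n$ matrix with entries $v_ia_j$. $\mathrm{SO}^*(2n)=\{q\in\mathrm{SU}(n,n)\ |\ q I_{nn}J_nq^t=I_{nn}J_n\}$, where $I_{nn}=\begin{pmatrix}-I_n&0\\0&I_n\end{pmatrix}$, $J_n=\begin{pmatrix}0&I_n\\-I_n&0\end{pmatrix}$ and $\mathrm{SU}(n,n)=\{q\in\mathrm{SL}_{2n}(\mathbb C)\ |\ qI_{nn}q^*=I_{nn}\}$. Its elements have the form $q=\begin{pmatrix}z&w\\-\bar w&\bar z\end{pmatrix}$ with $z,w\in\mathbb C^{n\times n}$, and such an element is written $z+jw$. The group carries its standard left-invariant Riemannian metric, induced by the scalar product $g(Z,W)=\mathrm{Re}\,\mathrm{trace}(ZW^* )$ on its Lie algebra. For complex valued functions $\phi,\psi$ on a Lie group with left-invariant Riemannian metric, the Laplacian (tension field) $\tau$ and the operator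 $\kappa(\phi,\psi)=g(\mathrm{grad}(\phi),\mathrm{grad}(\psi))$ ($g$ extended complex bilinearly) are given by $\tau(\phi)=\sum_{Z\in\mathcal B}Z^2(\phi)$ and $\kappa(\phi,\psi)=\sum_{Z\in\mathcal B}Z(\phi)Z(\psi)$, where here $\mathcal B$ is any orthonormal basis of the Lie algebra of left-invariant vector fields, $Z(\phi)(p)=\frac{d}{ds}[\phi(p\cdot\exp(sZ))]|_{s=0}$ and $Z^2(\phi)(p)=\frac{d^2}{ds^2}[\phi(p\cdot\exp(sZ))]|_{s=0}$. A set $\mathcal E$ of complex valued functions is an eigenfamily if there exist $\lambda,\mu\in\mathbb C$ with $\tau(\phi)=\lambda\phi$ and $\kappa(\phi,\psi)=\mu\phi\psi$ for all $\phi,\psi\in\mathcal E$. The union of two non-empty eigenfamilies $\mathcal E_1,\mathcal E_2$ (with possibly different constants) is a bi-eigenfamily if there exists $\mu\in\mathbb C$ with $\kappa(\phi,\psi)=\mu\phi\psi$ for all $\phi\in\mathcal E_1$, $\psi\in\mathcal E_2$. *)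

theory Defs
  imports "HOL-Analysis.Analysis"
begin

section \<open>Functions on matrix groups with a left-invariant metric\<close>

text \<open>
  A closed matrix group is a set \<open>G\<close> of complex square matrices, carrying the left-invariant
  metric induced by \<open>g(Z, W) = Re trace (Z W\<^sup>*)\<close> on its Lie algebra. Elements of the Lie algebra
  are identified with the left-invariant vector fields. A function on \<open>G\<close> is represented as a
  function on all matrices of which only the values on \<open>G\<close> are used.
\<close>

type_synonym 'm cmat = "complex ^ 'm ^ 'm"

definition adjoint_mat :: "complex ^ 'm ^ 'k \<Rightarrow> complex ^ 'k ^ 'm" where
  "adjoint_mat A = transpose (map_matrix cnj A)"

definition matrix_exp :: "'m::finite cmat \<Rightarrow> 'm cmat" where
  "matrix_exp Z = (\<Sum>k. (1 / fact k) *\<^sub>R (((**) Z) ^^ k) (mat 1))"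

definition lie_algebra :: "'m::finite cmat set \<Rightarrow> 'm cmat set" where
  "lie_algebra G = {Z. \<forall>s::real. matrix_exp (s *\<^sub>R Z) \<in> G}"

definition metric :: "'m::finite cmat \<Rightarrow> 'm cmat \<Rightarrow> real" where
  "metric Z W = Re (trace (Z ** adjoint_mat W))"

definition orthonormal_basis :: "'m::finite cmat set \<Rightarrow> 'm cmat set \<Rightarrow> bool" where
  "orthonormal_basis G B \<longleftrightarrow>
     B \<subseteq> lie_algebra G \<and> span B = lie_algebra G \<and>
     (\<forall>Z\<in>B. \<forall>W\<in>B. metric Z W = (if Z = W then 1 else 0))"

text \<open>The function \<open>\<phi>\<close> along the integral curve of the left-invariant field \<open>Z\<close> starting at \<open>p\<close>.\<close>

definition along :: "'m::finite cmat \<Rightarrow> ('m cmat \<Rightarrow> complex) \<Rightarrow> 'm cmat \<Rightarrow> real \<Rightarrow> complex" where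
  "along Z \<phi> p = (\<lambda>s. \<phi> (p ** matrix_exp (s *\<^sub>R Z)))"

definition field_deriv :: "'m::finite cmat \<Rightarrow> ('m cmat \<Rightarrow> complex) \<Rightarrow> 'm cmat \<Rightarrow> complex" where
  "field_deriv Z \<phi> p = vector_derivative (along Z \<phi> p) (at 0)"

definition field_deriv2 :: "'m::finite cmat \<Rightarrow> ('m cmat \<Rightarrow> complex) \<Rightarrow> 'm cmat \<Rightarrow> complex" where
  "field_deriv2 Z \<phi> p =
     vector_derivative (\<lambda>s. vector_derivative (along Z \<phi> p) (at s)) (at 0)"

text \<open>
  \<^const>\<open>vector_derivative\<close> is an arbitrary value where the derivative does not exist; the following
  makes \<^const>\<open>field_deriv\<close> and \<^const>\<open>field_deriv2\<close> meaningful.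
\<close>

definition twice_differentiable :: "'m::finite cmat set \<Rightarrow> ('m cmat \<Rightarrow> complex) \<Rightarrow> bool" where
  "twice_differentiable G \<phi> \<longleftrightarrow>
     (\<forall>Z\<in>lie_algebra G. \<forall>p\<in>G. \<forall>s.
        along Z \<phi> p differentiable (at s) \<and>
        (\<lambda>t. vector_derivative (along Z \<phi> p) (at t)) differentiable (at s))"

text \<open>
  The Laplacian and the conformality operator, computed in an orthonormal basis \<open>B\<close> of the Lie
  algebra. Their values do not depend on \<open>B\<close>.
\<close>

definition tension :: "'m::finite cmat set \<Rightarrow> ('m cmat \<Rightarrow> complex) \<Rightarrow> 'm cmat \<Rightarrow> complex" where
  "tension B \<phi> p = (\<Sum>Z\<in>B. field_deriv2 Z \<phi> p)"

definition conformality ::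
    "'m::finite cmat set \<Rightarrow> ('m cmat \<Rightarrow> complex) \<Rightarrow> ('m cmat \<Rightarrow> complex) \<Rightarrow> 'm cmat \<Rightarrow> complex" where
  "conformality B \<phi> \<psi> p = (\<Sum>Z\<in>B. field_deriv Z \<phi> p * field_deriv Z \<psi> p)"

definition eigenfamily :: "'m::finite cmat set \<Rightarrow> ('m cmat \<Rightarrow> complex) set \<Rightarrow> bool" where
  "eigenfamily G E \<longleftrightarrow>
     (\<forall>\<phi>\<in>E. twice_differentiable G \<phi>) \<and>
     (\<exists>lam mu :: complex. \<forall>B. orthonormal_basis G B \<longrightarrow>
        (\<forall>\<phi>\<in>E. \<forall>p\<in>G. tension B \<phi> p = lam * \<phi> p) \<and>
        (\<forall>\<phi>\<in>E. \<forall>\<psi>\<in>E. \<forall>p\<in>G. conformality B \<phi> \<psi> p = mu * \<phi> p * \<psi> p))"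

text \<open>\<open>bi_eigenfamily G E1 E2\<close>: the union of \<open>E1\<close> and \<open>E2\<close> is a bi-eigenfamily.\<close>

definition bi_eigenfamily ::
    "'m::finite cmat set \<Rightarrow> ('m cmat \<Rightarrow> complex) set \<Rightarrow> ('m cmat \<Rightarrow> complex) set \<Rightarrow> bool" where
  "bi_eigenfamily G E1 E2 \<longleftrightarrow>
     E1 \<noteq> {} \<and> E2 \<noteq> {} \<and> eigenfamily G E1 \<and> eigenfamily G E2 \<and>
     (\<exists>mu :: complex. \<forall>B. orthonormal_basis G B \<longrightarrow>
        (\<forall>\<phi>\<in>E1. \<forall>\<psi>\<in>E2. \<forall>p\<in>G. conformality B \<phi> \<psi> p = mu * \<phi> p * \<psi> p))"

text \<open>
  A complex vector space of functions on \<open>G\<close> with pointwise operations; functions on \<open>G\<close> are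
  normalised to be \<^const>\<open>undefined\<close> outside \<open>G\<close>.
\<close>

definition function_space :: "'m::finite cmat set \<Rightarrow> ('m cmat \<Rightarrow> complex) set \<Rightarrow> bool" where
  "function_space G E \<longleftrightarrow>
     E \<subseteq> extensional G \<and>
     (\<lambda>p\<in>G. 0) \<in> E \<and>
     (\<forall>\<phi>\<in>E. \<forall>\<psi>\<in>E. (\<lambda>p\<in>G. \<phi> p + \<psi> p) \<in> E) \<and>
     (\<forall>\<alpha>. \<forall>\<phi>\<in>E. (\<lambda>p\<in>G. \<alpha> * \<phi> p) \<in> E)"


section \<open>The group \<open>SO\<^sup>*(2n)\<close>\<close>

text \<open>With \<open>n = CARD('n)\<close>, the \<open>2n\<close> rows and columns are indexed by \<^typ>\<open>'n + 'n\<close>.\<close>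

definition block_mat ::
    "'n::finite cmat \<Rightarrow> 'n cmat \<Rightarrow> 'n cmat \<Rightarrow> 'n cmat \<Rightarrow> ('n + 'n) cmat" where
  "block_mat P Q R S = (\<chi> i j.
     case i of
       Inl a \<Rightarrow> (case j of Inl b \<Rightarrow> P $ a $ b | Inr b \<Rightarrow> Q $ a $ b)
     | Inr a \<Rightarrow> (case j of Inl b \<Rightarrow> R $ a $ b | Inr b \<Rightarrow> S $ a $ b))"

definition I_nn :: "('n::finite + 'n) cmat" where
  "I_nn = block_mat (- mat 1) 0 0 (mat 1)"

definition J_n :: "('n::finite + 'n) cmat" where
  "J_n = block_mat 0 (mat 1) (- mat 1) 0"

definition SU_nn :: "('n::finite + 'n) cmat set" where
  "SU_nn = {q. det q = 1 \<and> q ** I_nn ** adjoint_mat q = I_nn}"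

definition SO_star :: "('n::finite + 'n) cmat set" where
  "SO_star = {q \<in> SU_nn. q ** (I_nn ** J_n) ** transpose q = I_nn ** J_n}"

text \<open>The matrices \<open>z\<close> and \<open>w\<close> of \<open>q = z + jw\<close>.\<close>

definition z_part :: "('n::finite + 'n) cmat \<Rightarrow> 'n cmat" where
  "z_part q = (\<chi> i j. q $ Inl i $ Inl j)"

definition w_part :: "('n::finite + 'n) cmat \<Rightarrow> 'n cmat" where
  "w_part q = (\<chi> i j. q $ Inl i $ Inr j)"

lemma sum_UNIV_Plus:
  fixes f :: "'a::finite + 'b::finite \<Rightarrow> 'c::comm_monoid_add"
  shows "(\<Sum>k\<in>UNIV. f k) = (\<Sum>k\<in>UNIV. f (Inl k)) + (\<Sum>k\<in>UNIV. f (Inr k))"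
  unfolding UNIV_Plus_UNIV[symmetric] by (subst sum.Plus) auto

lemma block_mat_nth [simp]:
  "block_mat P Q R S $ Inl a $ Inl b = P $ a $ b"
  "block_mat P Q R S $ Inl a $ Inr b = Q $ a $ b"
  "block_mat P Q R S $ Inr a $ Inl b = R $ a $ b"
  "block_mat P Q R S $ Inr a $ Inr b = S $ a $ b"
  by (simp_all add: block_mat_def)

lemma cmat_sum_eq_iff:
  fixes A B :: "('n::finite + 'n) cmat"
  shows "A = B \<longleftrightarrow> (\<forall>a b. A $ Inl a $ Inl b = B $ Inl a $ Inl b \<and> A $ Inl a $ Inr b = B $ Inl a $ Inr b
    \<and> A $ Inr a $ Inl b = B $ Inr a $ Inl b \<and> A $ Inr a $ Inr b = B $ Inr a $ Inr b)"
proof -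
  have *: "(\<forall>i::'n + 'n. P i) \<longleftrightarrow> (\<forall>a. P (Inl a)) \<and> (\<forall>a. P (Inr a))" for P
    by (metis sum.exhaust)
  show ?thesis by (auto simp: vec_eq_iff *)
qed

lemma I_nn_squared: "(I_nn :: ('n::finite + 'n) cmat) ** I_nn = mat 1"
  by (simp add: cmat_sum_eq_iff matrix_matrix_mult_def sum_UNIV_Plus I_nn_def mat_def
      if_distrib if_distribR sum_negf cong: if_cong)

lemma I_J_I: "(I_nn :: ('n::finite + 'n) cmat) ** J_n ** I_nn = - J_n"
  by (simp add: cmat_sum_eq_iff matrix_matrix_mult_def sum_UNIV_Plus I_nn_def J_n_def mat_def
      if_distrib if_distribR sum_negf cong: if_cong)

lemma map_matrix_cnj_mult:
  "map_matrix cnj (A ** B) = map_matrix cnj A ** map_matrix cnj (B :: complex ^ 'k ^ 'm)"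
  by (simp add: vec_eq_iff matrix_matrix_mult_def)

lemma SO_star_J:
  fixes q :: "('n::finite + 'n) cmat"
  assumes "q \<in> SO_star"
  shows "q ** J_n = J_n ** map_matrix cnj q"
proof -
  let ?I = "I_nn :: ('n + 'n) cmat" and ?c = "map_matrix cnj q"
  have 1: "q ** ?I ** adjoint_mat q = ?I" and 2: "q ** (?I ** J_n) ** transpose q = ?I ** J_n"
    using assms by (auto simp: SO_star_def SU_nn_def)
  have cI: "map_matrix cnj ?I = ?I"
    by (simp add: cmat_sum_eq_iff I_nn_def mat_def)
  have "map_matrix cnj (adjoint_mat q) = transpose q"
    by (simp add: vec_eq_iff adjoint_mat_def transpose_def)
  hence "?c ** ?I ** transpose q = ?I"
    using arg_cong[OF 1, of "map_matrix cnj"] by (simp add: map_matrix_cnj_mult cI)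
  hence "?c ** (?I ** transpose q ** ?I) = mat 1"
    by (simp add: matrix_mul_assoc I_nn_squared)
  hence 3: "?I ** transpose q ** ?I ** ?c = mat 1"
    using matrix_left_right_inverse by blast
  have "transpose q ** ?I ** ?c = ?I ** (?I ** transpose q ** ?I ** ?c)"
    by (simp add: matrix_mul_assoc I_nn_squared)
  with 3 have 4: "transpose q ** ?I ** ?c = ?I"
    by simp
  have "q ** (?I ** J_n ** ?I) = q ** (?I ** J_n ** (transpose q ** ?I ** ?c))"
    by (simp only: 4)
  also have "\<dots> = q ** (?I ** J_n) ** transpose q ** ?I ** ?c"
    by (simp only: matrix_mul_assoc)
  also have "\<dots> = (?I ** J_n ** ?I) ** ?c"
    by (simp only: 2)
  finally have "q ** (- J_n) = (- J_n) ** ?c"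
    unfolding I_J_I .
  thus ?thesis
    by (simp add: vec_eq_iff matrix_matrix_mult_def sum_negf)
qed

lemma SO_star_block_form:
  fixes q :: "('n::finite + 'n) cmat"
  assumes "q \<in> SO_star"
  shows "q = block_mat (z_part q) (w_part q)
                       (- map_matrix cnj (w_part q)) (map_matrix cnj (z_part q))"
proof -
  have "q $ Inr a $ Inl b = - cnj (q $ Inl a $ Inr b) \<and> q $ Inr a $ Inr b = cnj (q $ Inl a $ Inl b)"
    for a b
  proof -
    have "(q ** J_n) $ Inl a $ j = (J_n ** map_matrix cnj q) $ Inl a $ j" for j
      by (simp add: SO_star_J[OF assms])
    from this[of "Inl b"] this[of "Inr b"]
    have "- q $ Inl a $ Inr b = cnj (q $ Inr a $ Inl b)"
      and "q $ Inl a $ Inl b = cnj (q $ Inr a $ Inr b)"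
      by (simp_all add: matrix_matrix_mult_def sum_UNIV_Plus J_n_def mat_def
          if_distrib if_distribR sum_negf cong: if_cong)
    from this[THEN arg_cong[where f = cnj]] show ?thesis
      by simp
  qed
  thus ?thesis
    by (simp add: cmat_sum_eq_iff z_part_def w_part_def)
qed

text \<open>
  The matrix \<open>v\<^sup>t a\<close>. The library's \<^const>\<open>columnvector\<close> and \<^const>\<open>rowvector\<close> repeat the vector
  along an arbitrary second index type, which has to be the one-element type here.
\<close>

definition col_times_row :: "complex ^ 'n::finite \<Rightarrow> complex ^ 'n \<Rightarrow> 'n cmat" where
  "col_times_row v a = (columnvector v :: complex ^ 1 ^ 'n) ** (rowvector a :: complex ^ 'n ^ 1)"

lemma col_times_row_nth: "col_times_row v a $ i $ j = v $ i * a $ j"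
  by (simp add: col_times_row_def matrix_matrix_mult_def columnvector_def rowvector_def)

definition E1 :: "complex ^ 'n::finite \<Rightarrow> (('n + 'n) cmat \<Rightarrow> complex) set" where
  "E1 v = {\<lambda>q\<in>SO_star. trace (col_times_row v a ** transpose (z_part q)) |
             a :: complex ^ 'n. True}"

definition E2 :: "complex ^ 'n::finite \<Rightarrow> (('n + 'n) cmat \<Rightarrow> complex) set" where
  "E2 v = {\<lambda>q\<in>SO_star. trace (col_times_row v c ** transpose (w_part q)) |
             c :: complex ^ 'n. True}"

end

theory Submission
  imports Defs
begin

text \<open>
  All functions in question are matrix coefficients \<open>q \<mapsto> u q b\<^sup>t\<close>, with a row vector
  \<open>u = (v, 0)\<close> that is the same for all of them and a column vector \<open>b\<close>. Writing
  \<open>q = z + jw\<close>, the family \<open>E1\<close> consists of the coefficients with \<open>b = (a, 0)\<close> and \<open>E2\<close> of those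
  with \<open>b = (0, c)\<close>; these are the two eigenspaces of \<open>I\<^sub>n\<^sub>n\<close>, for the eigenvalues \<open>-1\<close> and \<open>1\<close>.

  A matrix coefficient is linear in \<open>q\<close>, so the field \<open>Z\<close> maps it to \<open>u q Z b\<^sup>t\<close> and \<open>Z\<^sup>2\<close> maps it to
  \<open>u q Z\<^sup>2 b\<^sup>t\<close>. Both operators are therefore determined by the sums
  \<open>\<Sum> Z\<^sub>k\<^sub>l Z\<^sub>i\<^sub>j\<close> over an orthonormal basis. These sums are read off from the orthogonal projection onto
  the Lie algebra. The Lie algebra is the common fixed space of two commuting self-adjoint
  involutions \<open>\<sigma>\<close>, \<open>\<rho>\<close> (\<open>unitary_involution\<close>, \<open>orthogonal_involution\<close>),
  so its projection is \<open>(1 + \<sigma>)(1 + \<rho>) / 4\<close>, and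
  only the part of the projection that is conjugate linear over the complex numbers contributes. This
  gives (lemma \<open>basis_covariance\<close>)
  \<open>\<Sum> Z\<^sub>k\<^sub>l Z\<^sub>i\<^sub>j = - (I\<^sub>i\<^sub>l I\<^sub>k\<^sub>j + J\<^sub>i\<^sub>k J\<^sub>l\<^sub>j) / 2\<close>,
  where \<open>I\<close> and \<open>J\<close> stand for \<open>I\<^sub>n\<^sub>n\<close> and \<open>J\<^sub>n\<close>.

  Contracting \<open>l = i\<close> and using \<open>trace I = 0\<close> gives \<open>\<Sum> Z\<^sup>2 = - 1/2\<close>, hence \<open>\<tau>(\<phi>) = - \<phi>/2\<close> for every
  matrix coefficient. For \<open>\<kappa>\<close> put \<open>x = u q\<close>. In \<open>\<Sum> (x Z b\<^sup>t)(x Z c\<^sup>t)\<close> the \<open>J\<close>-term carries the factor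
  \<open>x J x\<^sup>t\<close>, which vanishes because \<open>J\<close> is skew-symmetric; here it matters that all functions share
  the same \<open>u\<close>. What remains is \<open>- (x I b\<^sup>t)(x I c\<^sup>t) / 2\<close>, and if \<open>b\<close>, \<open>c\<close> are eigenvectors of
  \<open>I\<close> for \<open>e\<close>, \<open>f\<close>, this is \<open>- e f / 2\<close> times the product of the two functions. So \<open>\<mu> = - 1/2\<close> inside
  each family and \<open>\<mu> = 1/2\<close> across them.

  To know that the orthonormal bases span exactly the fixed space of \<open>\<sigma>\<close> and \<open>\<rho>\<close>, one has to
  prove both inclusions between that space and the Lie algebra, which is given through one-parameter
  groups (lemma \<open>lie_algebra_SO_star\<close>). This rests on the
  derivative of \<open>s \<mapsto> exp (s Z)\<close>: the curve \<open>exp (s Z)\<close> preserves a form iff \<open>Z\<close> does so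
  infinitesimally, and determinant 1 follows from the preserved complex bilinear form.
\<close>

section \<open>Differentiating the matrix exponential\<close>

lemma matrix_mult_scaleR_left: "(r *\<^sub>R A) ** B = r *\<^sub>R (A ** (B :: complex ^ 'k ^ 'm))"
  for A :: "complex ^ 'm ^ 'l"
  by (simp add: vec_eq_iff matrix_matrix_mult_def scaleR_sum_right)

lemma matrix_mult_scaleR_right: "A ** (r *\<^sub>R B) = r *\<^sub>R (A ** (B :: complex ^ 'k ^ 'm))"
  for A :: "complex ^ 'm ^ 'l"
  by (simp add: vec_eq_iff matrix_matrix_mult_def scaleR_sum_right)

lemma matrix_mult_minus_left: "(- A) ** B = - (A ** (B :: complex ^ 'k ^ 'm))"
  for A :: "complex ^ 'm ^ 'l"
  by (simp add: vec_eq_iff matrix_matrix_mult_def sum_negf)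

lemma matrix_mult_minus_right: "A ** (- B) = - (A ** (B :: complex ^ 'k ^ 'm))"
  for A :: "complex ^ 'm ^ 'l"
  by (simp add: vec_eq_iff matrix_matrix_mult_def sum_negf)

lemma matrix_add_rdistrib: "(A + B) ** C = A ** C + B ** (C :: complex ^ 'k ^ 'm)"
  for A :: "complex ^ 'm ^ 'l"
  by (simp add: vec_eq_iff matrix_matrix_mult_def distrib_right sum.distrib)

lemma bounded_bilinear_matrix_mult:
  "bounded_bilinear ((**) :: 'm::finite cmat \<Rightarrow> 'm cmat \<Rightarrow> 'm cmat)"
  unfolding bilinear_conv_bounded_bilinear[symmetric] bilinear_def
  by (auto intro!: linearI simp: matrix_add_ldistrib matrix_mult_scaleR_left
      matrix_mult_scaleR_right matrix_add_rdistrib)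

lemma bounded_linear_matrix_mult_left:
  "bounded_linear (\<lambda>X. (A :: 'm::finite cmat) ** (X :: 'm cmat))"
  by (rule bounded_bilinear.bounded_linear_right[OF bounded_bilinear_matrix_mult])

lemma bounded_linear_matrix_mult_right:
  "bounded_linear (\<lambda>X. (X :: 'm::finite cmat) ** (A :: 'm cmat))"
  by (rule bounded_bilinear.bounded_linear_left[OF bounded_bilinear_matrix_mult])

text \<open>Lets matrix-valued curves be differentiated entry by entry.\<close>

lemma has_vector_derivative_vec:
  fixes f :: "real \<Rightarrow> 'a::euclidean_space ^ 'm::finite"
  assumes "\<And>i. ((\<lambda>x. f x $ i) has_vector_derivative d $ i) (at s)"
  shows "(f has_vector_derivative d) (at s)"
  unfolding has_vector_derivative_def
proof (subst has_derivative_componentwise_within, intro ballI)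
  fix b :: "'a ^ 'm" assume "b \<in> Basis"
  then obtain i u where b: "b = axis i u" "u \<in> Basis"
    by (auto simp: Basis_vec_def)
  show "((\<lambda>x. f x \<bullet> b) has_derivative (\<lambda>x. (x *\<^sub>R d) \<bullet> b)) (at s)"
    using has_derivative_inner_left[OF assms[of i, unfolded has_vector_derivative_def], of u]
    by (simp add: b inner_axis)
qed

definition matrix_power :: "'m::finite cmat \<Rightarrow> nat \<Rightarrow> 'm cmat" where
  "matrix_power Z k = (((**) Z) ^^ k) (mat 1)"

lemma matrix_power_simps [simp]:
  "matrix_power Z 0 = mat 1"
  "matrix_power Z (Suc k) = Z ** matrix_power Z k"
  by (simp_all add: matrix_power_def)

lemma matrix_power_Suc_right: "matrix_power Z (Suc k) = matrix_power Z k ** Z"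
  by (induction k) (simp_all add: matrix_mul_assoc)

lemma matrix_power_scaleR: "matrix_power (s *\<^sub>R Z) k = s ^ k *\<^sub>R matrix_power Z k"
  by (induction k) (simp_all add: matrix_mult_scaleR_left matrix_mult_scaleR_right mult_ac)

lemma norm_matrix_power_bound:
  fixes Z :: "'m::finite cmat"
  obtains K where "\<And>k. norm (matrix_power Z k) \<le> K ^ k * norm (mat 1 :: 'm cmat)" "K \<ge> 0"
proof -
  obtain K where K: "\<And>X :: 'm cmat. norm (Z ** X) \<le> norm X * K" "K \<ge> 0"
    using bounded_linear.nonneg_bounded[OF bounded_linear_matrix_mult_left[of Z]] by metis
  have "norm (matrix_power Z k) \<le> K ^ k * norm (mat 1 :: 'm cmat)" for k
  proof (induction k)
    case (Suc k)
    have "norm (matrix_power Z (Suc k)) \<le> norm (matrix_power Z k) * K"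
      using K(1) by simp
    also have "\<dots> \<le> (K ^ k * norm (mat 1 :: 'm cmat)) * K"
      using Suc K(2) by (intro mult_right_mono)
    finally show ?case by (simp add: mult_ac)
  qed simp
  thus thesis using that K(2) by blast
qed

text \<open>
  Absolute convergence with every weight \<open>r ^ k\<close> serves twice: for \<open>r = \<bar>s\<bar>\<close> it is the convergence of
  the series of matrices, and for arbitrary \<open>r\<close> it makes each entry a power series in \<open>s\<close> with
  infinite radius of convergence, which may be differentiated termwise.
\<close>

lemma summable_matrix_power_series:
  "summable (\<lambda>k. norm ((1 / fact k) *\<^sub>R matrix_power Z k) * r ^ k)" if "r \<ge> 0"
proof -
  obtain K where K: "\<And>k. norm (matrix_power Z k) \<le> K ^ k * norm (mat 1 :: 'a cmat)" "K \<ge> 0"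
    by (rule norm_matrix_power_bound) blast
  show ?thesis
  proof (rule summable_comparison_test')
    show "summable (\<lambda>k. norm (mat 1 :: 'a cmat) * (inverse (fact k) * (K * r) ^ k))"
      by (intro summable_mult summable_exp)
    show "norm (norm ((1 / fact k) *\<^sub>R matrix_power Z k) * r ^ k)
      \<le> norm (mat 1 :: 'a cmat) * (inverse (fact k) * (K * r) ^ k)" if "k \<ge> 0" for k
      using mult_right_mono[OF K(1)[of k], of "inverse (fact k) * r ^ k"] \<open>r \<ge> 0\<close>
      by (simp add: power_mult_distrib abs_mult field_simps)
  qed
qed

lemma matrix_exp_eq: "matrix_exp (s *\<^sub>R Z) = (\<Sum>k. s ^ k *\<^sub>R ((1 / fact k) *\<^sub>R matrix_power Z k))"
  unfolding matrix_exp_def matrix_power_def[symmetric] matrix_power_scaleR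
  by (simp add: mult_ac)

lemma matrix_exp_nth:
  "matrix_exp (s *\<^sub>R Z) $ i $ j = (\<Sum>k. (matrix_power Z k $ i $ j / fact k) * of_real s ^ k)"
proof -
  let ?f = "\<lambda>k. s ^ k *\<^sub>R ((1 / fact k) *\<^sub>R matrix_power Z k)"
  have sm: "summable ?f"
    using summable_matrix_power_series[of "\<bar>s\<bar>" Z]
    by (intro summable_norm_cancel[of ?f]) (simp add: power_abs mult_ac)
  have bl: "bounded_linear (\<lambda>X :: 'a cmat. X $ i $ j)"
    using bounded_linear_compose[OF bounded_linear_vec_nth bounded_linear_vec_nth] by fast
  show ?thesis
    unfolding matrix_exp_eq bounded_linear.suminf[OF bl sm]
    by (rule arg_cong[of _ _ suminf]) (simp add: fun_eq_iff, simp add: scaleR_conv_of_real)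
qed

lemma matrix_exp_0: "matrix_exp 0 = mat 1"
proof -
  have "matrix_exp 0 $ i $ j = mat 1 $ i $ j" for i j :: 'a
    using powser_zero[of "\<lambda>k. matrix_power 0 k $ i $ j / fact k"] matrix_exp_nth[of 0 "0 :: 'a cmat" i j]
    by (simp del: powser_zero)
  thus ?thesis by (simp add: vec_eq_iff)
qed

text \<open>
  Each entry of \<open>exp (s Z)\<close> is a power series in \<open>s\<close>. Its formal derivative has the coefficients of
  \<open>Z\<^sup>k\<^sup>+\<^sup>1 / k!\<close>, and splitting off the last factor of \<open>Z\<^sup>k\<^sup>+\<^sup>1 = Z\<^sup>k Z\<close> gives \<open>exp (s Z) Z\<close>.
\<close>

lemma matrix_exp_has_vector_derivative:
  "((\<lambda>s. matrix_exp (s *\<^sub>R Z)) has_vector_derivative matrix_exp (s *\<^sub>R Z) ** Z) (at s)"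
proof (intro has_vector_derivative_vec)
  fix i j :: 'a
  define c where "c m = (\<lambda>k. matrix_power Z k $ i $ m / fact k)" for m
  have sm: "summable (\<lambda>k. c m k * y ^ k)" for m y
  proof (rule summable_comparison_test'[OF summable_matrix_power_series[of "norm y" Z]])
    fix k :: nat
    have "norm (matrix_power Z k $ i $ m) \<le> norm (matrix_power Z k)"
      using Finite_Cartesian_Product.norm_nth_le[of "matrix_power Z k" i]
        Finite_Cartesian_Product.norm_nth_le[of "matrix_power Z k $ i" m]
      by (rule order_trans[rotated])
    thus "norm (c m k * y ^ k) \<le> norm ((1 / fact k) *\<^sub>R matrix_power Z k) * norm y ^ k"
      by (simp add: c_def norm_mult norm_divide norm_power divide_right_mono mult_right_mono)
  qed simp
  have "diffs (c j) k = (\<Sum>m\<in>UNIV. c m k * Z $ m $ j)" for k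
  proof -
    have "diffs (c j) k = matrix_power Z (Suc k) $ i $ j / fact k"
      by (simp add: diffs_def c_def field_simps del: of_nat_Suc)
    also have "\<dots> = (\<Sum>m\<in>UNIV. c m k * Z $ m $ j)"
      unfolding matrix_power_Suc_right
      by (simp add: c_def matrix_matrix_mult_def sum_divide_distrib)
    finally show ?thesis .
  qed
  hence "(\<Sum>k. diffs (c j) k * y ^ k) = (\<Sum>k. \<Sum>m\<in>UNIV. (c m k * y ^ k) * Z $ m $ j)" for y
    by (simp add: sum_distrib_right sum_distrib_left mult_ac)
  also have "\<dots> y = (\<Sum>m\<in>UNIV. (\<Sum>k. c m k * y ^ k) * Z $ m $ j)" for y
    by (subst suminf_sum) (auto intro!: summable_mult2 sm simp: suminf_mult2[OF sm, symmetric])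
  finally have "((\<lambda>y. \<Sum>k. c j k * y ^ k) has_field_derivative
       (\<Sum>m\<in>UNIV. (\<Sum>k. c m k * y ^ k) * Z $ m $ j)) (at y)" for y
    using termdiffs_strong_converges_everywhere[of "c j" y] sm by simp
  from has_vector_derivative_real_field[OF this[of "of_real s"]]
  show "((\<lambda>s. matrix_exp (s *\<^sub>R Z) $ i $ j) has_vector_derivative
      (matrix_exp (s *\<^sub>R Z) ** Z) $ i $ j) (at s)"
    by (simp add: matrix_exp_nth c_def matrix_matrix_mult_def)
qed

text \<open>
  The factor \<open>C\<close> allows the lemma to be applied again to the derivative that it provides.
\<close>

lemma linear_along_exp_has_vector_derivative:
  fixes L :: "'m::finite cmat \<Rightarrow> complex" and A Z C :: "'m cmat"
  assumes "linear L"
  shows "((\<lambda>s. L (A ** matrix_exp (s *\<^sub>R Z) ** C)) has_vector_derivative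
           L (A ** matrix_exp (s *\<^sub>R Z) ** (Z ** C))) (at s)"
proof -
  have "bounded_linear L"
    using assms by (simp add: linear_conv_bounded_linear)
  then have "bounded_linear (\<lambda>X. L (A ** X ** C))"
    using bounded_linear_compose[OF bounded_linear_matrix_mult_right
        bounded_linear_matrix_mult_left]
    by (rule bounded_linear_compose)
  from bounded_linear.has_vector_derivative[OF this matrix_exp_has_vector_derivative]
  show ?thesis by (simp add: matrix_mul_assoc)
qed

section \<open>One-parameter groups preserving a form\<close>

text \<open>
  The derivative of \<open>q M N(q)\<close> along \<open>q = exp (s Z)\<close> is \<open>q (Z M + M N(Z)) N(q)\<close>: it vanishes
  identically if the infinitesimal condition holds, and at \<open>s = 0\<close> it equals the left-hand side of that
  condition. The map \<open>N\<close> is an abstract transposition so that the conjugate transpose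
  and the transpose, which define the two forms of the group, are covered at once.
\<close>

lemma exp_preserves_form_iff:
  fixes N :: "'m::finite cmat \<Rightarrow> 'm cmat"
  assumes lin: "linear N" and anti: "\<And>A B. N (A ** B) = N B ** N A"
    and one: "N (mat 1) = mat 1"
  shows "(\<forall>s. matrix_exp (s *\<^sub>R Z) ** M ** N (matrix_exp (s *\<^sub>R Z)) = M)
         \<longleftrightarrow> Z ** M + M ** N Z = 0"
proof -
  let ?q = "\<lambda>s. matrix_exp (s *\<^sub>R Z)"
  have bl: "bounded_linear N"
    using lin by (simp add: linear_conv_bounded_linear)
  have deriv: "((\<lambda>s. ?q s ** M ** N (?q s)) has_vector_derivative
          ?q s ** (Z ** M + M ** N Z) ** N (?q s)) (at s)" for s
    using bounded_bilinear.has_vector_derivative[OF bounded_bilinear_matrix_mult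
        bounded_linear.has_vector_derivative[OF bounded_linear_matrix_mult_right
          matrix_exp_has_vector_derivative]
        bounded_linear.has_vector_derivative[OF bl matrix_exp_has_vector_derivative]]
    by (simp add: anti matrix_mul_assoc matrix_add_ldistrib matrix_add_rdistrib add.commute)
  show ?thesis
  proof
    assume "\<forall>s. ?q s ** M ** N (?q s) = M"
    hence "((\<lambda>s. ?q s ** M ** N (?q s)) has_vector_derivative 0) (at 0)"
      by simp
    from vector_derivative_unique_at[OF deriv[of 0] this]
    show "Z ** M + M ** N Z = 0"
      by (simp add: matrix_exp_0 one)
  next
    assume *: "Z ** M + M ** N Z = 0"
    show "\<forall>s. ?q s ** M ** N (?q s) = M"
    proof
      fix s
      have "?q s ** M ** N (?q s) = ?q 0 ** M ** N (?q 0)"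
      proof (rule has_derivative_zero_unique[of UNIV "\<lambda>s. ?q s ** M ** N (?q s)"])
        show "((\<lambda>s. ?q s ** M ** N (?q s)) has_derivative (\<lambda>h. 0)) (at s within UNIV)" for s
          using deriv[of s] * by (simp add: has_vector_derivative_def)
      qed auto
      thus "?q s ** M ** N (?q s) = M"
        by (simp add: matrix_exp_0 one)
    qed
  qed
qed

text \<open>
  Preserving a nondegenerate bilinear form forces \<open>det = \<plusminus>1\<close>, and continuity along the
  one-parameter group excludes \<open>-1\<close>.
\<close>

lemma det_exp_eq_1:
  fixes Z M :: "'m::finite cmat"
  assumes inv: "\<And>s. matrix_exp (s *\<^sub>R Z) ** M ** transpose (matrix_exp (s *\<^sub>R Z)) = M"
    and M: "det M \<noteq> 0"
  shows "det (matrix_exp Z) = 1"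
proof -
  let ?d = "\<lambda>s::real. det (matrix_exp (s *\<^sub>R Z))"
  have "?d s * ?d s = 1" for s
  proof -
    have "?d s * det M * ?d s = det M"
      using arg_cong[OF inv[of s], of det] by (simp add: det_mul)
    thus ?thesis using M by simp
  qed
  hence "range ?d \<subseteq> {1, -1}"
    by (auto simp: square_eq_1_iff)
  moreover have "continuous_on UNIV ?d"
  proof -
    have q: "continuous_on UNIV (\<lambda>s. matrix_exp (s *\<^sub>R Z))"
      using matrix_exp_has_vector_derivative
      by (intro continuous_at_imp_continuous_on ballI)
        (blast intro: has_vector_derivative_continuous)
    show ?thesis
      unfolding det_def by (intro continuous_intros q)
  qed
  ultimately have "?d constant_on UNIV"
    by (intro continuous_finite_range_constant) (auto intro: finite_subset)
  then have "?d 1 = ?d 0"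
    unfolding constant_on_def by (metis UNIV_I)
  thus ?thesis by (simp add: matrix_exp_0)
qed


section \<open>The Lie algebra of the group and its orthogonal projection\<close>

lemma transpose_I_nn: "transpose I_nn = I_nn"
  and transpose_J_n: "transpose J_n = - J_n"
  and cnj_I_nn: "map_matrix cnj I_nn = I_nn"
  and cnj_J_n: "map_matrix cnj J_n = J_n"
  by (auto simp: cmat_sum_eq_iff I_nn_def J_n_def mat_def transpose_def)

lemma J_n_squared: "J_n ** J_n = - mat 1"
  and J_I: "J_n ** I_nn = - (I_nn ** J_n)"
  by (simp_all add: cmat_sum_eq_iff matrix_matrix_mult_def sum_UNIV_Plus I_nn_def J_n_def mat_def
      if_distrib if_distribR sum_negf cong: if_cong)

lemma adjoint_mat_mult: "adjoint_mat (A ** B) = adjoint_mat B ** adjoint_mat A"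
  for A B :: "'m::finite cmat"
  by (simp add: adjoint_mat_def map_matrix_cnj_mult matrix_transpose_mul)

lemma adjoint_mat_nth: "adjoint_mat A $ i $ j = cnj (A $ j $ i)"
  by (simp add: adjoint_mat_def transpose_def)

lemma adjoint_mat_adjoint: "adjoint_mat (adjoint_mat A) = A"
  by (simp add: vec_eq_iff adjoint_mat_nth)

lemma adjoint_I_nn: "adjoint_mat I_nn = I_nn"
  by (simp add: adjoint_mat_def cnj_I_nn transpose_I_nn)

lemma transpose_nth: "transpose A $ i $ j = A $ j $ i"
  by (simp add: transpose_def)

abbreviation IJ :: "('n::finite + 'n) cmat" where
  "IJ \<equiv> I_nn ** J_n"

lemma IJ_squared: "IJ ** IJ = mat 1"
proof -
  have "IJ ** IJ = I_nn ** (J_n ** I_nn) ** J_n"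
    by (simp add: matrix_mul_assoc)
  also have "\<dots> = - (I_nn ** I_nn ** (J_n ** J_n))"
    by (simp only: J_I matrix_mult_minus_left matrix_mult_minus_right matrix_mul_assoc)
  also have "\<dots> = mat 1"
    by (simp add: I_nn_squared J_n_squared)
  finally show ?thesis .
qed

lemma transpose_IJ: "transpose IJ = IJ"
  by (simp add: matrix_transpose_mul transpose_I_nn transpose_J_n J_I matrix_mult_minus_left)

lemma cnj_IJ: "map_matrix cnj IJ = IJ"
  by (simp add: map_matrix_cnj_mult cnj_I_nn cnj_J_n)

text \<open>
  The infinitesimal forms of the two defining equations of the group, solved for \<open>Z\<close>: the matrices
  \<open>I\<^sub>n\<^sub>n\<close> and \<open>I\<^sub>n\<^sub>n J\<^sub>n\<close> are their own inverses, so \<open>Z I\<^sub>n\<^sub>n + I\<^sub>n\<^sub>n Z\<^sup>* = 0\<close> says that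
  \<open>Z\<close> is fixed by the first map and \<open>Z I\<^sub>n\<^sub>n J\<^sub>n + I\<^sub>n\<^sub>n J\<^sub>n Z\<^sup>t = 0\<close> that it is fixed by the second.
  The first is conjugate linear, the second complex linear.
\<close>

definition unitary_involution :: "('n::finite + 'n) cmat \<Rightarrow> ('n + 'n) cmat" where
  "unitary_involution Z = - (I_nn ** adjoint_mat Z ** I_nn)"

definition orthogonal_involution :: "('n::finite + 'n) cmat \<Rightarrow> ('n + 'n) cmat" where
  "orthogonal_involution Z = - (IJ ** transpose Z ** IJ)"

lemma preserves_form_iff_fixed:
  fixes Z K W :: "'m::finite cmat"
  assumes "K ** K = mat 1"
  shows "Z ** K + K ** W = 0 \<longleftrightarrow> - (K ** W ** K) = Z"
proof
  assume "Z ** K + K ** W = 0"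
  hence "K ** W = - (Z ** K)"
    by (simp add: eq_neg_iff_add_eq_0 add.commute)
  thus "- (K ** W ** K) = Z"
    by (simp add: matrix_mult_minus_left matrix_mul_assoc[symmetric] assms)
next
  assume Z: "- (K ** W ** K) = Z"
  have "Z ** K = - (K ** W)"
    by (simp add: Z[symmetric] matrix_mult_minus_left matrix_mul_assoc[symmetric] assms)
  thus "Z ** K + K ** W = 0" by simp
qed

lemma linear_adjoint_mat: "linear (adjoint_mat :: 'm::finite cmat \<Rightarrow> _)"
  by (auto intro!: linearI simp: vec_eq_iff adjoint_mat_nth)

lemma linear_transpose: "linear (transpose :: 'm::finite cmat \<Rightarrow> _)"
  by (auto intro!: linearI simp: vec_eq_iff transpose_nth)

lemma lie_algebra_SO_star:
  "lie_algebra (SO_star :: ('n::finite + 'n) cmat set)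
    = {Z. unitary_involution Z = Z \<and> orthogonal_involution Z = Z}"
proof (intro set_eqI)
  fix Z :: "('n + 'n) cmat"
  let ?q = "\<lambda>s. matrix_exp (s *\<^sub>R Z)"
  have U: "(\<forall>s. ?q s ** I_nn ** adjoint_mat (?q s) = I_nn) \<longleftrightarrow> unitary_involution Z = Z"
    unfolding unitary_involution_def preserves_form_iff_fixed[OF I_nn_squared, symmetric]
    by (rule exp_preserves_form_iff[OF linear_adjoint_mat adjoint_mat_mult])
      (auto simp: vec_eq_iff adjoint_mat_nth mat_def)
  have O: "(\<forall>s. ?q s ** IJ ** transpose (?q s) = IJ) \<longleftrightarrow> orthogonal_involution Z = Z"
    unfolding orthogonal_involution_def preserves_form_iff_fixed[OF IJ_squared, symmetric]
    by (rule exp_preserves_form_iff[OF linear_transpose matrix_transpose_mul]) simp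
  have "det (?q s) = 1" if "\<forall>s. ?q s ** IJ ** transpose (?q s) = IJ" for s
  proof (rule det_exp_eq_1)
    show "matrix_exp (t *\<^sub>R s *\<^sub>R Z) ** IJ ** transpose (matrix_exp (t *\<^sub>R s *\<^sub>R Z)) = IJ" for t
      using that by simp
    have "det (IJ ** IJ :: ('n + 'n) cmat) = 1"
      by (simp add: IJ_squared)
    thus "det (IJ :: ('n + 'n) cmat) \<noteq> 0"
      by (metis det_mul mult_zero_left zero_neq_one)
  qed
  with U O show "Z \<in> lie_algebra SO_star \<longleftrightarrow> Z \<in> {Z. unitary_involution Z = Z \<and> orthogonal_involution Z = Z}"
    unfolding lie_algebra_def SO_star_def SU_nn_def by blast
qed

lemma unitary_involution_add: "unitary_involution (X + Y) = unitary_involution X + unitary_involution Y"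
  and unitary_involution_scaleR: "unitary_involution (r *\<^sub>R X) = r *\<^sub>R unitary_involution X"
  by (simp_all add: unitary_involution_def linear_add[OF linear_adjoint_mat] linear_cmul[OF linear_adjoint_mat]
      matrix_add_ldistrib matrix_add_rdistrib matrix_mult_scaleR_left matrix_mult_scaleR_right)

lemma orthogonal_involution_add: "orthogonal_involution (X + Y) = orthogonal_involution X + orthogonal_involution Y"
  and orthogonal_involution_scaleR: "orthogonal_involution (r *\<^sub>R X) = r *\<^sub>R orthogonal_involution X"
  by (simp_all add: orthogonal_involution_def linear_add[OF linear_transpose] linear_cmul[OF linear_transpose]
      matrix_add_ldistrib matrix_add_rdistrib matrix_mult_scaleR_left matrix_mult_scaleR_right)

lemma map_matrix_cnj_minus: "map_matrix cnj (- A) = - map_matrix cnj A"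
  by (simp add: vec_eq_iff)

lemma transpose_minus: "transpose (- A) = - transpose (A :: complex ^ 'k ^ 'm)"
  by (simp add: vec_eq_iff transpose_def)

lemma unitary_involution_idem: "unitary_involution (unitary_involution X) = X"
proof -
  have "adjoint_mat (unitary_involution X) = - (I_nn ** X ** I_nn)"
    by (simp add: unitary_involution_def adjoint_mat_mult linear_neg[OF linear_adjoint_mat]
        adjoint_mat_adjoint adjoint_I_nn matrix_mul_assoc)
  hence "unitary_involution (unitary_involution X) = (I_nn ** I_nn) ** X ** (I_nn ** I_nn)"
    unfolding unitary_involution_def[of "unitary_involution X"]
    by (simp only: matrix_mult_minus_left matrix_mult_minus_right matrix_mul_assoc minus_minus)
  thus ?thesis by (simp add: I_nn_squared)
qed

lemma transpose_orthogonal_involution: "transpose (orthogonal_involution X) = - (IJ ** X ** IJ)"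
  by (simp only: orthogonal_involution_def transpose_minus matrix_transpose_mul[of _ IJ] matrix_transpose_mul[of IJ]
      transpose_IJ transpose_transpose)
    (simp only: matrix_mul_assoc)

lemma orthogonal_involution_idem: "orthogonal_involution (orthogonal_involution X) = X"
proof -
  have "orthogonal_involution (orthogonal_involution X) = (IJ ** IJ) ** X ** (IJ ** IJ)"
    unfolding orthogonal_involution_def[of "orthogonal_involution X"] transpose_orthogonal_involution
    by (simp only: matrix_mult_minus_left matrix_mult_minus_right matrix_mul_assoc minus_minus)
  thus ?thesis by (simp add: IJ_squared)
qed

lemma I_IJ: "I_nn ** IJ = J_n" and IJ_I: "IJ ** I_nn = - J_n"
  by (simp_all add: matrix_mul_assoc I_nn_squared I_J_I)

text \<open>
  On the fixed space of this product \<open>Z J\<^sub>n\<close> equals \<open>J\<^sub>n\<close> times the conjugate of \<open>Z\<close>, which is the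
  block form \<open>z + jw\<close>.
\<close>

lemma unitary_orthogonal_involution: "unitary_involution (orthogonal_involution X) = - (J_n ** map_matrix cnj X ** J_n)"
proof -
  have "adjoint_mat (orthogonal_involution X) = map_matrix cnj (transpose (orthogonal_involution X))"
    by (simp add: vec_eq_iff adjoint_mat_nth transpose_nth)
  also have "\<dots> = - (IJ ** map_matrix cnj X ** IJ)"
    by (simp only: transpose_orthogonal_involution map_matrix_cnj_minus map_matrix_cnj_mult[of _ IJ]
        map_matrix_cnj_mult[of IJ] cnj_IJ)
  finally have "adjoint_mat (orthogonal_involution X) = - (IJ ** map_matrix cnj X ** IJ)" .
  hence "unitary_involution (orthogonal_involution X) = (I_nn ** IJ) ** map_matrix cnj X ** (IJ ** I_nn)"
    unfolding unitary_involution_def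
    by (simp only: matrix_mult_minus_left matrix_mult_minus_right matrix_mul_assoc minus_minus)
  thus ?thesis
    by (simp only: I_IJ IJ_I matrix_mult_minus_right)
qed

lemma involutions_commute: "orthogonal_involution (unitary_involution X) = unitary_involution (orthogonal_involution X)"
proof -
  have "transpose (unitary_involution X) = - (I_nn ** map_matrix cnj X ** I_nn)"
    by (simp add: unitary_involution_def adjoint_mat_def transpose_minus matrix_transpose_mul transpose_I_nn
        matrix_mul_assoc)
  hence "orthogonal_involution (unitary_involution X) = (IJ ** I_nn) ** map_matrix cnj X ** (I_nn ** IJ)"
    unfolding orthogonal_involution_def
    by (simp only: matrix_mult_minus_left matrix_mult_minus_right matrix_mul_assoc minus_minus)
  thus ?thesis
    by (simp only: unitary_orthogonal_involution I_IJ IJ_I matrix_mult_minus_left)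
qed

lemma metric_eq_inner: "metric Z W = Z \<bullet> W"
  by (simp add: metric_def trace_def matrix_matrix_mult_def adjoint_mat_nth inner_vec_def
      inner_complex_def)

lemma trace_transpose: "trace (transpose A) = trace (A :: 'm::finite cmat)"
  by (simp add: trace_def transpose_def)

lemma Re_trace_adjoint: "Re (trace (adjoint_mat A)) = Re (trace A)"
  by (simp add: trace_def adjoint_mat_nth)

lemma trace_minus: "trace (- A) = - trace (A :: 'm::finite cmat)"
  by (simp add: trace_def sum_negf)

text \<open>
  Both self-adjointness statements hold because the real part of a trace is unchanged by the
  conjugate transpose, the trace by the transpose, and both by cyclic permutation.
\<close>

lemma unitary_involution_self_adjoint: "unitary_involution X \<bullet> W = X \<bullet> unitary_involution W"
proof -
  have "unitary_involution X \<bullet> W = - Re (trace (adjoint_mat (I_nn ** adjoint_mat X ** I_nn ** adjoint_mat W)))"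
    by (simp add: metric_eq_inner[symmetric] metric_def unitary_involution_def matrix_mult_minus_left trace_minus
        Re_trace_adjoint)
  also have "\<dots> = - Re (trace (W ** (I_nn ** X ** I_nn)))"
    by (simp add: adjoint_mat_mult adjoint_mat_adjoint adjoint_I_nn matrix_mul_assoc)
  also have "\<dots> = - Re (trace (X ** (I_nn ** W ** I_nn)))"
    using trace_mul_sym[of "W ** I_nn" "X ** I_nn"] trace_mul_sym[of "W ** I_nn ** X" I_nn]
      trace_mul_sym[of I_nn "X ** I_nn ** W"]
    by (simp add: matrix_mul_assoc)
  also have "\<dots> = X \<bullet> unitary_involution W"
    by (simp add: metric_eq_inner[symmetric] metric_def unitary_involution_def linear_neg[OF linear_adjoint_mat]
        adjoint_mat_mult adjoint_mat_adjoint adjoint_I_nn matrix_mult_minus_right trace_minus matrix_mul_assoc)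
  finally show ?thesis .
qed

lemma orthogonal_involution_self_adjoint: "orthogonal_involution X \<bullet> W = X \<bullet> orthogonal_involution W"
proof -
  have tadj: "transpose (adjoint_mat W) = map_matrix cnj W"
    by (simp add: adjoint_mat_def)
  have adjK: "adjoint_mat (IJ :: ('a + 'a) cmat) = IJ"
    by (simp only: adjoint_mat_def cnj_IJ transpose_IJ)
  have adjt: "adjoint_mat (transpose W) = map_matrix cnj W"
    by (simp add: vec_eq_iff adjoint_mat_nth transpose_nth)
  have "orthogonal_involution X \<bullet> W = - Re (trace (transpose (IJ ** transpose X ** IJ ** adjoint_mat W)))"
    by (simp only: metric_eq_inner[symmetric] metric_def orthogonal_involution_def matrix_mult_minus_left trace_minus
        trace_transpose uminus_complex.simps)
  also have "\<dots> = - Re (trace (map_matrix cnj W ** (IJ ** X ** IJ)))"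
    by (simp only: matrix_transpose_mul[of _ "adjoint_mat W"] matrix_transpose_mul[of _ IJ]
        matrix_transpose_mul[of IJ] tadj transpose_IJ transpose_transpose)
      (simp only: matrix_mul_assoc)
  also have "\<dots> = - Re (trace (X ** (IJ ** map_matrix cnj W ** IJ)))"
    using trace_mul_sym[of "map_matrix cnj W ** IJ" "X ** IJ"]
    by (simp add: matrix_mul_assoc)
  also have "\<dots> = X \<bullet> orthogonal_involution W"
    by (simp only: metric_eq_inner[symmetric] metric_def orthogonal_involution_def linear_neg[OF linear_adjoint_mat]
        adjoint_mat_mult[of _ IJ] adjoint_mat_mult[of IJ] adjt adjK matrix_mult_minus_right
        trace_minus uminus_complex.simps)
      (simp only: matrix_mul_assoc)
  finally show ?thesis .
qed

text \<open>
  The product of the orthogonal projections onto the fixed spaces of the two commuting involutions.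
\<close>

definition lie_proj :: "('n::finite + 'n) cmat \<Rightarrow> ('n + 'n) cmat" where
  "lie_proj X = (1 / 4) *\<^sub>R (X + orthogonal_involution X + unitary_involution X
    + unitary_involution (orthogonal_involution X))"

lemma lie_proj_in_lie_algebra: "lie_proj X \<in> lie_algebra SO_star"
  by (simp add: lie_algebra_SO_star lie_proj_def unitary_involution_add orthogonal_involution_add
      unitary_involution_scaleR orthogonal_involution_scaleR unitary_involution_idem orthogonal_involution_idem involutions_commute add_ac)

lemma lie_proj_inner:
  assumes "Z \<in> lie_algebra SO_star"
  shows "lie_proj X \<bullet> Z = X \<bullet> Z"
proof -
  have "unitary_involution Z = Z" "orthogonal_involution Z = Z"
    using assms by (auto simp: lie_algebra_SO_star)
  thus ?thesis
    by (simp add: lie_proj_def inner_add_left unitary_involution_self_adjoint orthogonal_involution_self_adjoint)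
qed

section \<open>Sums over an orthonormal basis\<close>

lemma orthonormal_basis_expand_lie_proj:
  assumes "orthonormal_basis SO_star B"
  shows "(\<Sum>Z\<in>B. (X \<bullet> Z) *\<^sub>R Z) = lie_proj X"
proof -
  have B: "B \<subseteq> lie_algebra SO_star" "span B = lie_algebra SO_star"
    and orth: "\<And>Z W. Z \<in> B \<Longrightarrow> W \<in> B \<Longrightarrow> Z \<bullet> W = (if Z = W then 1 else 0)"
    using assms by (auto simp: orthonormal_basis_def metric_eq_inner)
  have pw: "pairwise orthogonal B"
    by (simp add: pairwise_def orthogonal_def orth)
  have "0 \<notin> B"
    using orth[of 0 0] by auto
  with pw have "finite B"
    using pairwise_orthogonal_independent independent_imp_finite by blast
  moreover have "norm Z = 1" if "Z \<in> B" for Z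
    using orth[OF that that] by (simp add: norm_eq_sqrt_inner)
  moreover have "lie_proj X \<in> span B"
    using B(2) lie_proj_in_lie_algebra by blast
  ultimately have "(\<Sum>Z\<in>B. (lie_proj X \<bullet> Z) *\<^sub>R Z) = lie_proj X"
    using pw by (intro orthonormal_basis_expand)
  moreover have "(\<Sum>Z\<in>B. (lie_proj X \<bullet> Z) *\<^sub>R Z) = (\<Sum>Z\<in>B. (X \<bullet> Z) *\<^sub>R Z)"
    using B(1) by (intro sum.cong refl) (metis lie_proj_inner subsetD)
  ultimately show ?thesis by simp
qed

lemma matrix_mult_axis:
  fixes A B :: "'m::finite cmat"
  shows "(A ** axis k (axis l c) ** B) $ i $ j = A $ i $ k * c * B $ l $ j"
proof -
  have ax: "axis k y $ h = (if h = k then y else 0)" for y :: "complex ^ 'm" and h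
    by (simp add: axis_def)
  have "(A ** axis k (axis l c)) $ i $ m = (if m = l then A $ i $ k * c else 0)" for m
  proof -
    have "(A ** axis k (axis l c)) $ i $ m
      = (\<Sum>h\<in>UNIV. if h = k then A $ i $ k * axis l c $ m else 0)"
      by (simp only: matrix_matrix_mult_def vec_lambda_beta) (intro sum.cong refl, simp add: ax)
    thus ?thesis by (simp add: axis_def)
  qed
  thus ?thesis
    by (simp add: matrix_matrix_mult_def[of _ B] if_distrib[of "\<lambda>x. x * _"] cong: if_cong)
qed

text \<open>
  The entry \<open>Z\<^sub>k\<^sub>l\<close> is \<open>\<langle>E, Z\<rangle> + \<i> \<langle>\<i>E, Z\<rangle>\<close> for the elementary matrix \<open>E\<close> with entry 1 at \<open>(k, l)\<close>
  and the real inner product. Hence the sum is an entry of \<open>P E + \<i> P (\<i> E)\<close> with \<open>P\<close> the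
  projection onto the Lie algebra. In this expression the complex linear part of \<open>P\<close> cancels and the
  conjugate linear part counts twice.
\<close>

lemma basis_covariance:
  assumes "orthonormal_basis SO_star B"
  shows "(\<Sum>Z\<in>B. Z $ k $ l * Z $ i $ j)
    = - (I_nn $ i $ l * I_nn $ k $ j + J_n $ i $ k * J_n $ l $ j) / 2"
proof -
  let ?E = "\<lambda>c. axis k (axis l c)"
  have tr: "transpose (?E c) = axis l (axis k c)"
    and cj: "map_matrix cnj (?E c) = axis k (axis l (cnj c))"
    and ad: "adjoint_mat (?E c) = axis l (axis k (cnj c))" for c
    by (auto simp: vec_eq_iff transpose_nth adjoint_mat_nth axis_def)
  have proj: "lie_proj (?E c) $ i $ j = (1 / 4) *\<^sub>R (c * ?E 1 $ i $ j - c * (IJ $ i $ l * IJ $ k $ j)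
      - cnj c * (I_nn $ i $ l * I_nn $ k $ j + J_n $ i $ k * J_n $ l $ j))" for c
  proof -
    have "lie_proj (?E c) $ i $ j = (1 / 4) *\<^sub>R (?E c $ i $ j - IJ $ i $ l * c * IJ $ k $ j
      - I_nn $ i $ l * cnj c * I_nn $ k $ j - J_n $ i $ k * cnj c * J_n $ l $ j)"
      unfolding lie_proj_def unitary_orthogonal_involution unfolding unitary_involution_def orthogonal_involution_def tr cj ad
      by (simp only: vector_scaleR_component vector_add_component vector_uminus_component
          matrix_mult_axis) simp
    moreover have "?E c $ i $ j = c * ?E 1 $ i $ j"
      by (simp add: axis_def)
    ultimately show ?thesis by (simp add: algebra_simps)
  qed
  have "(\<Sum>Z\<in>B. Z $ k $ l * Z $ i $ j)
      = (\<Sum>Z\<in>B. ((?E 1 \<bullet> Z) *\<^sub>R Z) $ i $ j) + \<i> * (\<Sum>Z\<in>B. ((?E \<i> \<bullet> Z) *\<^sub>R Z) $ i $ j)"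
    unfolding sum_distrib_left sum.distrib[symmetric]
  proof (intro sum.cong refl)
    fix Z :: "('a + 'a) cmat"
    have "Z $ k $ l = of_real (?E 1 \<bullet> Z) + \<i> * of_real (?E \<i> \<bullet> Z)"
      by (simp add: inner_axis' inner_complex_def complex_eq_iff)
    thus "Z $ k $ l * Z $ i $ j
        = ((?E 1 \<bullet> Z) *\<^sub>R Z) $ i $ j + \<i> * ((?E \<i> \<bullet> Z) *\<^sub>R Z) $ i $ j"
      by (simp add: scaleR_conv_of_real[where 'a = complex] algebra_simps)
  qed
  also have "\<dots> = lie_proj (?E 1) $ i $ j + \<i> * lie_proj (?E \<i>) $ i $ j"
    by (simp only: orthonormal_basis_expand_lie_proj[OF assms, symmetric] sum_component)
  also have "\<dots> = - (I_nn $ i $ l * I_nn $ k $ j + J_n $ i $ k * J_n $ l $ j) / 2"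
    unfolding proj by (simp add: scaleR_conv_of_real field_simps)
  finally show ?thesis .
qed

text \<open>
  Of the two contracted terms of the covariance, the first contains \<open>trace I\<^sub>n\<^sub>n = 0\<close> and the second is
  \<open>J\<^sub>n\<^sup>t J\<^sub>n\<close>, the identity.
\<close>

lemma basis_sum_squares:
  assumes "orthonormal_basis SO_star B"
  shows "(\<Sum>Z\<in>B. Z ** Z) = (- 1 / 2) *\<^sub>R (mat 1 :: ('n::finite + 'n) cmat)"
proof -
  have tr: "(\<Sum>m\<in>UNIV. (I_nn :: ('n + 'n) cmat) $ m $ m) = 0"
    by (simp add: sum_UNIV_Plus I_nn_def mat_def sum_negf)
  have JJ: "(\<Sum>m\<in>UNIV. J_n $ m $ i * J_n $ m $ j) = mat 1 $ i $ j" for i j :: "'n + 'n"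
  proof -
    have "(\<Sum>m\<in>UNIV. J_n $ m $ i * J_n $ m $ j) = (transpose J_n ** J_n) $ i $ j"
      by (simp add: matrix_matrix_mult_def transpose_nth)
    thus ?thesis
      by (simp add: transpose_J_n matrix_mult_minus_left J_n_squared)
  qed
  have "(\<Sum>Z\<in>B. Z ** Z) $ i $ j = ((- 1 / 2) *\<^sub>R (mat 1 :: ('n + 'n) cmat)) $ i $ j" for i j
  proof -
    have "(\<Sum>Z\<in>B. Z ** Z) $ i $ j = (\<Sum>m\<in>UNIV. \<Sum>Z\<in>B. Z $ i $ m * Z $ m $ j)"
      unfolding sum.swap[of _ B] by (simp add: matrix_matrix_mult_def)
    also have "\<dots> = - ((\<Sum>m\<in>UNIV. (I_nn :: ('n + 'n) cmat) $ m $ m) * I_nn $ i $ j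
        + (\<Sum>m\<in>UNIV. J_n $ m $ i * J_n $ m $ j)) / 2"
      unfolding basis_covariance[OF assms]
      by (simp add: sum_negf sum.distrib sum_subtractf sum_distrib_right sum_divide_distrib[symmetric])
    finally show ?thesis
      unfolding tr JJ by (simp add: scaleR_conv_of_real[where 'a = complex])
  qed
  thus ?thesis by (simp add: vec_eq_iff)
qed

definition matrix_coeff :: "complex ^ 'm::finite \<Rightarrow> complex ^ 'm \<Rightarrow> 'm cmat \<Rightarrow> complex" where
  "matrix_coeff u b q = (\<Sum>i\<in>UNIV. \<Sum>j\<in>UNIV. u $ i * q $ i $ j * b $ j)"

lemma linear_matrix_coeff: "linear (matrix_coeff u b)"
  by (auto intro!: linearI simp: matrix_coeff_def algebra_simps sum.distrib scaleR_sum_right)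

lemma matrix_coeff_mult_left: "matrix_coeff u b (p ** q) = matrix_coeff (u v* p) b q"
proof -
  have "matrix_coeff u b (p ** q)
     = (\<Sum>i\<in>UNIV. \<Sum>j\<in>UNIV. \<Sum>m\<in>UNIV. u $ i * p $ i $ m * q $ m $ j * b $ j)"
    by (simp add: matrix_coeff_def matrix_matrix_mult_def sum_distrib_left sum_distrib_right mult_ac)
  also have "\<dots> = (\<Sum>m\<in>UNIV. \<Sum>j\<in>UNIV. \<Sum>i\<in>UNIV. u $ i * p $ i $ m * q $ m $ j * b $ j)"
    by (subst sum.swap, subst sum.swap[of _ UNIV UNIV], rule sum.cong, rule refl, subst sum.swap)
      simp
  also have "\<dots> = matrix_coeff (u v* p) b q"
    by (simp add: matrix_coeff_def vector_matrix_mult_def sum_distrib_left sum_distrib_right mult_ac)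
  finally show ?thesis .
qed

lemma matrix_coeff_eq_dot: "matrix_coeff u b q = (\<Sum>j\<in>UNIV. (u v* q) $ j * b $ j)"
  unfolding matrix_coeff_def
  by (subst sum.swap) (simp add: vector_matrix_mult_def sum_distrib_left sum_distrib_right mult_ac)

lemma matrix_coeff_eigenvector:
  assumes "K *v b = e *s b"
  shows "matrix_coeff u b (q ** K) = e * matrix_coeff u b q"
proof -
  have *: "(\<Sum>j\<in>UNIV. x $ j * (\<Sum>l\<in>UNIV. K $ j $ l * b $ l)) = e * (\<Sum>j\<in>UNIV. x $ j * b $ j)" for x
    using assms by (simp add: vec_eq_iff matrix_vector_mult_def sum_distrib_left mult_ac)
  have "matrix_coeff u b (q ** K) = matrix_coeff (u v* q) b K"
    by (rule matrix_coeff_mult_left)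
  also have "\<dots> = e * (\<Sum>j\<in>UNIV. (u v* q) $ j * b $ j)"
    unfolding *[symmetric] by (simp add: matrix_coeff_def sum_distrib_left mult_ac)
  also have "\<dots> = e * matrix_coeff u b q"
    by (simp only: matrix_coeff_eq_dot)
  finally show ?thesis .
qed

lemma matrix_coeff_J_n_isotropic: "matrix_coeff x x J_n = 0"
proof -
  have "matrix_coeff x x J_n = matrix_coeff x x (transpose J_n)"
    unfolding matrix_coeff_def by (subst sum.swap) (simp add: transpose_nth mult_ac)
  also have "\<dots> = - matrix_coeff x x J_n"
    unfolding transpose_J_n by (rule linear_neg[OF linear_matrix_coeff])
  finally show ?thesis by simp
qed

text \<open>
  The two summands of the covariance pair the indices differently: in the first each \<open>x\<close> meets
  one of \<open>b\<close>, \<open>c\<close>, in the second the two factors \<open>x\<close> meet each other and \<open>b\<close> meets \<open>c\<close>. The second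
  one drops out since \<open>x\<close> is isotropic for the alternating form \<open>J\<^sub>n\<close>.
\<close>

lemma basis_sum_matrix_coeff:
  assumes "orthonormal_basis SO_star B"
  shows "(\<Sum>Z\<in>B. matrix_coeff x b Z * matrix_coeff x c Z)
    = - (1 / 2) * matrix_coeff x b I_nn * matrix_coeff x c I_nn"
proof -
  have swap1: "(\<Sum>k\<in>UNIV. \<Sum>l\<in>UNIV. \<Sum>i\<in>UNIV. \<Sum>j\<in>UNIV. F k j * G i l)
      = (\<Sum>k\<in>UNIV. \<Sum>j\<in>UNIV. F k j) * (\<Sum>i\<in>UNIV. \<Sum>l\<in>UNIV. G i l)"
    for F G :: "'a + 'a \<Rightarrow> 'a + 'a \<Rightarrow> complex"
    unfolding sum.swap[of "\<lambda>i l. G i l"]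
    by (simp only: sum_distrib_right[symmetric] sum_distrib_left[symmetric])
  have swap2: "(\<Sum>k\<in>UNIV. \<Sum>l\<in>UNIV. \<Sum>i\<in>UNIV. \<Sum>j\<in>UNIV. F i k * G l j)
      = (\<Sum>i\<in>UNIV. \<Sum>k\<in>UNIV. F i k) * (\<Sum>l\<in>UNIV. \<Sum>j\<in>UNIV. G l j)"
    for F G :: "'a + 'a \<Rightarrow> 'a + 'a \<Rightarrow> complex"
    unfolding sum.swap[of "\<lambda>i k. F i k"]
    by (simp only: sum_distrib_right[symmetric] sum_distrib_left[symmetric])
  have "(\<Sum>Z\<in>B. matrix_coeff x b Z * matrix_coeff x c Z)
     = (\<Sum>Z\<in>B. \<Sum>k\<in>UNIV. \<Sum>l\<in>UNIV. \<Sum>i\<in>UNIV. \<Sum>j\<in>UNIV.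
          (x $ k * Z $ k $ l * b $ l) * (x $ i * Z $ i $ j * c $ j))"
    unfolding matrix_coeff_def sum_distrib_right unfolding sum_distrib_left ..
  also have "\<dots> = (\<Sum>k\<in>UNIV. \<Sum>l\<in>UNIV. \<Sum>i\<in>UNIV. \<Sum>j\<in>UNIV. \<Sum>Z\<in>B.
          (x $ k * Z $ k $ l * b $ l) * (x $ i * Z $ i $ j * c $ j))"
    unfolding sum.swap[of _ B] ..
  also have "\<dots> = (\<Sum>k\<in>UNIV. \<Sum>l\<in>UNIV. \<Sum>i\<in>UNIV. \<Sum>j\<in>UNIV.
          x $ k * b $ l * x $ i * c $ j * (\<Sum>Z\<in>B. Z $ k $ l * Z $ i $ j))"
    by (simp add: sum_distrib_left mult_ac)
  also have "\<dots> = (\<Sum>k\<in>UNIV. \<Sum>l\<in>UNIV. \<Sum>i\<in>UNIV. \<Sum>j\<in>UNIV.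
          - (1 / 2) * ((x $ k * I_nn $ k $ j * c $ j) * (x $ i * I_nn $ i $ l * b $ l))
          + - (1 / 2) * ((x $ i * J_n $ i $ k * x $ k) * (b $ l * J_n $ l $ j * c $ j)))"
    unfolding basis_covariance[OF assms]
    by (intro sum.cong refl) (simp add: field_simps)
  also have "\<dots> = - (1 / 2) * (matrix_coeff x c I_nn * matrix_coeff x b I_nn)
        + - (1 / 2) * (matrix_coeff x x J_n * matrix_coeff b c J_n)"
    unfolding matrix_coeff_def
      swap1[of "\<lambda>k j. x $ k * I_nn $ k $ j * c $ j" "\<lambda>i l. x $ i * I_nn $ i $ l * b $ l", symmetric]
      swap2[of "\<lambda>i k. x $ i * J_n $ i $ k * x $ k" "\<lambda>l j. b $ l * J_n $ l $ j * c $ j", symmetric]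
    unfolding sum_distrib_left sum.distrib ..
  finally show ?thesis
    by (simp add: matrix_coeff_J_n_isotropic)
qed

section \<open>Linear functions restricted to a matrix group\<close>

text \<open>
  A function that is only specified on \<open>G\<close> may be replaced by its linear extension, because the
  integral curves of left-invariant fields stay in \<open>G\<close>.
\<close>

lemma along_restrict:
  assumes mult: "\<And>p q. p \<in> G \<Longrightarrow> q \<in> G \<Longrightarrow> p ** q \<in> G"
    and "Z \<in> lie_algebra G" "p \<in> G"
  shows "along Z (restrict L G) p = (\<lambda>s. L (p ** matrix_exp (s *\<^sub>R Z)))"
  using assms by (simp add: along_def lie_algebra_def)

lemma
  fixes L :: "'m::finite cmat \<Rightarrow> complex"
  assumes mult: "\<And>p q. p \<in> G \<Longrightarrow> q \<in> G \<Longrightarrow> p ** q \<in> G"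
    and L: "linear L" and Z: "Z \<in> lie_algebra G" and p: "p \<in> G"
  shows field_deriv_linear: "field_deriv Z (restrict L G) p = L (p ** Z)"
    and field_deriv2_linear: "field_deriv2 Z (restrict L G) p = L (p ** (Z ** Z))"
    and along_linear_differentiable: "along Z (restrict L G) p differentiable (at s)"
    and along_linear_differentiable2:
      "(\<lambda>t. vector_derivative (along Z (restrict L G) p) (at t)) differentiable (at s)"
proof -
  have along: "along Z (restrict L G) p = (\<lambda>s. L (p ** matrix_exp (s *\<^sub>R Z)))"
    by (rule along_restrict[OF mult Z p])
  note D = linear_along_exp_has_vector_derivative[OF L, of p Z]
  have D1: "(along Z (restrict L G) p has_vector_derivative L (p ** matrix_exp (s *\<^sub>R Z) ** Z)) (at s)"
    for s using D[of "mat 1" s] by (simp add: along)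
  hence d1: "(\<lambda>t. vector_derivative (along Z (restrict L G) p) (at t))
      = (\<lambda>s. L (p ** matrix_exp (s *\<^sub>R Z) ** Z))"
    by (auto simp: vector_derivative_at)
  have D2: "((\<lambda>t. vector_derivative (along Z (restrict L G) p) (at t)) has_vector_derivative
      L (p ** matrix_exp (s *\<^sub>R Z) ** (Z ** Z))) (at s)" for s
    unfolding d1 by (rule D)
  show "field_deriv Z (restrict L G) p = L (p ** Z)"
    using vector_derivative_at[OF D1[of 0]] by (simp add: field_deriv_def matrix_exp_0)
  show "field_deriv2 Z (restrict L G) p = L (p ** (Z ** Z))"
    using vector_derivative_at[OF D2[of 0]] by (simp add: field_deriv2_def matrix_exp_0)
  show "along Z (restrict L G) p differentiable (at s)"
    using D1 by (rule differentiableI_vector)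
  show "(\<lambda>t. vector_derivative (along Z (restrict L G) p) (at t)) differentiable (at s)"
    using D2 by (rule differentiableI_vector)
qed

lemma SO_star_mult:
  assumes "p \<in> SO_star" "q \<in> SO_star"
  shows "p ** q \<in> (SO_star :: ('n::finite + 'n) cmat set)"
proof -
  have "p ** q ** M ** (q' ** p') = M"
    if "q ** M ** q' = M" "p ** M ** p' = M" for M p' q' :: "('n + 'n) cmat"
  proof -
    have "p ** q ** M ** (q' ** p') = p ** (q ** M ** q') ** p'"
      by (simp add: matrix_mul_assoc)
    thus ?thesis using that by simp
  qed
  thus ?thesis
    using assms unfolding SO_star_def SU_nn_def
    by (simp add: det_mul adjoint_mat_mult matrix_transpose_mul)
qed

section \<open>The families as spaces of matrix coefficients\<close>

text \<open>
  Taking \<open>b\<close> from an eigenspace of \<open>I\<^sub>n\<^sub>n\<close> turns the products \<open>(x I\<^sub>n\<^sub>n b\<^sup>t)(x I\<^sub>n\<^sub>n c\<^sup>t)\<close> back into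
  multiples of products of the functions themselves, and treats both families uniformly.
\<close>

definition coeff_space :: "complex ^ ('n::finite + 'n) \<Rightarrow> complex \<Rightarrow> (('n + 'n) cmat \<Rightarrow> complex) set" where
  "coeff_space u e = {restrict (matrix_coeff u b) SO_star | b. I_nn *v b = e *s b}"

lemma coeff_spaceE:
  assumes "\<phi> \<in> coeff_space u e"
  obtains b where "\<phi> = restrict (matrix_coeff u b) SO_star" "I_nn *v b = e *s b"
  using assms by (auto simp: coeff_space_def)

lemma tension_coeff_space:
  assumes B: "orthonormal_basis SO_star B" and "\<phi> \<in> coeff_space u e" and p: "p \<in> SO_star"
  shows "tension B \<phi> p = - (1 / 2) * \<phi> p"
proof -
  obtain b where \<phi>: "\<phi> = restrict (matrix_coeff u b) SO_star"
    using assms(2) by (rule coeff_spaceE)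
  have sub: "B \<subseteq> lie_algebra SO_star"
    using B by (simp add: orthonormal_basis_def)
  have "tension B \<phi> p = (\<Sum>Z\<in>B. matrix_coeff u b (p ** (Z ** Z)))"
    unfolding tension_def \<phi> using sub p
    by (intro sum.cong refl field_deriv2_linear linear_matrix_coeff SO_star_mult) auto
  also have "\<dots> = matrix_coeff u b (p ** (\<Sum>Z\<in>B. Z ** Z))"
    by (simp add: linear_sum[OF linear_matrix_coeff]
        linear_sum[OF bounded_linear.linear[OF bounded_linear_matrix_mult_left]])
  also have "\<dots> = - (1 / 2) * matrix_coeff u b p"
    unfolding basis_sum_squares[OF B] matrix_mult_scaleR_right linear_cmul[OF linear_matrix_coeff]
    by (simp add: scaleR_conv_of_real)
  finally show ?thesis using p by (simp add: \<phi>)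
qed

lemma conformality_coeff_space:
  assumes B: "orthonormal_basis SO_star B" and "\<phi> \<in> coeff_space u e" "\<psi> \<in> coeff_space u f"
    and p: "p \<in> SO_star"
  shows "conformality B \<phi> \<psi> p = - (e * f / 2) * \<phi> p * \<psi> p"
proof -
  obtain b where \<phi>: "\<phi> = restrict (matrix_coeff u b) SO_star" and b: "I_nn *v b = e *s b"
    using assms(2) by (rule coeff_spaceE)
  obtain c where \<psi>: "\<psi> = restrict (matrix_coeff u c) SO_star" and c: "I_nn *v c = f *s c"
    using assms(3) by (rule coeff_spaceE)
  have sub: "B \<subseteq> lie_algebra SO_star"
    using B by (simp add: orthonormal_basis_def)
  have "field_deriv Z (restrict (matrix_coeff u a) SO_star) p = matrix_coeff (u v* p) a Z"
    if "Z \<in> B" for Z a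
    using field_deriv_linear[OF SO_star_mult linear_matrix_coeff _ p] that sub
    by (auto simp: matrix_coeff_mult_left)
  hence "conformality B \<phi> \<psi> p
      = (\<Sum>Z\<in>B. matrix_coeff (u v* p) b Z * matrix_coeff (u v* p) c Z)"
    by (simp add: conformality_def \<phi> \<psi>)
  also have "\<dots> = - (1 / 2) * matrix_coeff u b (p ** I_nn) * matrix_coeff u c (p ** I_nn)"
    by (simp only: basis_sum_matrix_coeff[OF B] matrix_coeff_mult_left)
  also have "\<dots> = - (e * f / 2) * matrix_coeff u b p * matrix_coeff u c p"
    by (simp add: matrix_coeff_eigenvector[OF b] matrix_coeff_eigenvector[OF c])
  finally show ?thesis using p by (simp add: \<phi> \<psi>)
qed

lemma twice_differentiable_coeff_space:
  assumes "\<phi> \<in> coeff_space u e"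
  shows "twice_differentiable SO_star \<phi>"
  using assms unfolding twice_differentiable_def
  by (auto elim!: coeff_spaceE intro!: along_linear_differentiable along_linear_differentiable2
      SO_star_mult linear_matrix_coeff)

lemma eigenfamily_coeff_space: "eigenfamily SO_star (coeff_space u e)"
  unfolding eigenfamily_def
  using twice_differentiable_coeff_space tension_coeff_space conformality_coeff_space by blast

lemma zero_in_coeff_space: "(\<lambda>p\<in>SO_star. 0) \<in> coeff_space u e"
  by (auto simp: coeff_space_def matrix_coeff_def fun_eq_iff restrict_def intro!: exI[of _ 0])

lemma function_space_coeff_space: "function_space SO_star (coeff_space u e)"
proof -
  have "(\<lambda>p\<in>SO_star. \<phi> p + \<psi> p) \<in> coeff_space u e"
    if "\<phi> \<in> coeff_space u e" "\<psi> \<in> coeff_space u e" for \<phi> \<psi>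
  proof -
    obtain b c where "\<phi> = restrict (matrix_coeff u b) SO_star" "I_nn *v b = e *s b"
      "\<psi> = restrict (matrix_coeff u c) SO_star" "I_nn *v c = e *s c"
      using \<open>\<phi> \<in> _\<close> \<open>\<psi> \<in> _\<close> unfolding coeff_space_def by blast
    thus ?thesis
      by (auto simp: coeff_space_def matrix_coeff_def fun_eq_iff restrict_def algebra_simps
          sum.distrib matrix_vector_right_distrib vector_add_ldistrib intro!: exI[of _ "b + c"])
  qed
  moreover have "(\<lambda>p\<in>SO_star. \<alpha> * \<phi> p) \<in> coeff_space u e" if "\<phi> \<in> coeff_space u e" for \<alpha> \<phi>
  proof -
    obtain b where "\<phi> = restrict (matrix_coeff u b) SO_star" "I_nn *v b = e *s b"
      using \<open>\<phi> \<in> _\<close> by (rule coeff_spaceE)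
    thus ?thesis
      by (auto simp: coeff_space_def matrix_coeff_def fun_eq_iff restrict_def mult_ac
          sum_distrib_left vector_scalar_commute intro!: exI[of _ "\<alpha> *s b"])
  qed
  moreover have "coeff_space u e \<subseteq> extensional SO_star"
    by (auto simp: coeff_space_def)
  ultimately show ?thesis
    by (simp add: function_space_def zero_in_coeff_space)
qed

definition vec_join :: "complex ^ 'n \<Rightarrow> complex ^ 'n \<Rightarrow> complex ^ ('n::finite + 'n)" where
  "vec_join a c = (\<chi> k. case k of Inl i \<Rightarrow> a $ i | Inr i \<Rightarrow> c $ i)"

lemma vec_join_nth [simp]: "vec_join a c $ Inl i = a $ i" "vec_join a c $ Inr i = c $ i"
  by (simp_all add: vec_join_def)

lemma vec_join_exhaust: obtains a c where "b = vec_join a c"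
proof
  show "b = vec_join (\<chi> i. b $ Inl i) (\<chi> i. b $ Inr i)"
    by (simp add: vec_eq_iff vec_join_def split: sum.split)
qed

lemma vec_join_eq_iff: "vec_join a c = vec_join a' c' \<longleftrightarrow> a = a' \<and> c = c'"
  by (metis vec_eq_iff vec_join_nth)

lemma I_nn_vec_join: "I_nn *v vec_join a c = vec_join (- a) c"
proof -
  have "(I_nn *v vec_join a c) $ k = vec_join (- a) c $ k" for k
    by (cases k) (simp_all add: matrix_vector_mult_def sum_UNIV_Plus I_nn_def mat_def
        if_distrib if_distribR sum_negf cong: if_cong)
  thus ?thesis by (simp add: vec_eq_iff)
qed

lemma scale_vec_join: "e *s vec_join a c = vec_join (e *s a) (e *s c)"
  by (simp add: vec_eq_iff vec_join_def split: sum.split)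

lemma trace_col_times_row: "trace (col_times_row v a ** transpose M)
    = (\<Sum>i\<in>UNIV. \<Sum>j\<in>UNIV. v $ i * M $ i $ j * a $ j)"
  by (simp add: trace_def matrix_matrix_mult_def transpose_def col_times_row_nth mult_ac)

lemma E1_eq_coeff_space: "E1 v = coeff_space (vec_join v 0) (- 1)"
proof -
  have neg: "(- 1) *s a = - a" "a = - a \<longleftrightarrow> a = 0" for a :: "complex ^ 'a"
    by (auto simp: vec_eq_iff complex_eq_iff)
  have eigen: "I_nn *v b = (- 1) *s b \<longleftrightarrow> (\<exists>a. b = vec_join a 0)" for b :: "complex ^ ('a + 'a)"
    by (rule vec_join_exhaust[of b])
      (auto simp: I_nn_vec_join scale_vec_join vec_join_eq_iff neg)
  have coeff: "restrict (matrix_coeff (vec_join v 0) (vec_join a 0)) SO_star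
      = (\<lambda>q\<in>SO_star. trace (col_times_row v a ** transpose (z_part q)))" for a
    by (intro restrict_ext)
      (simp add: trace_col_times_row matrix_coeff_def sum_UNIV_Plus z_part_def)
  have "coeff_space (vec_join v 0) (- 1)
      = {restrict (matrix_coeff (vec_join v 0) (vec_join a 0)) SO_star | a. True}"
    unfolding coeff_space_def eigen by blast
  thus ?thesis
    by (simp only: E1_def coeff)
qed

lemma E2_eq_coeff_space: "E2 v = coeff_space (vec_join v 0) 1"
proof -
  have neg: "- a = a \<longleftrightarrow> a = 0" for a :: "complex ^ 'a"
    by (auto simp: vec_eq_iff complex_eq_iff)
  have eigen: "I_nn *v b = 1 *s b \<longleftrightarrow> (\<exists>c. b = vec_join 0 c)" for b :: "complex ^ ('a + 'a)"
    by (rule vec_join_exhaust[of b])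
      (auto simp: I_nn_vec_join vec_join_eq_iff neg)
  have coeff: "restrict (matrix_coeff (vec_join v 0) (vec_join 0 c)) SO_star
      = (\<lambda>q\<in>SO_star. trace (col_times_row v c ** transpose (w_part q)))" for c
    by (intro restrict_ext)
      (simp add: trace_col_times_row matrix_coeff_def sum_UNIV_Plus w_part_def)
  have "coeff_space (vec_join v 0) 1
      = {restrict (matrix_coeff (vec_join v 0) (vec_join 0 c)) SO_star | c. True}"
    unfolding coeff_space_def eigen by blast
  thus ?thesis
    by (simp only: E2_def coeff)
qed

theorem theorem8p2:
  fixes v :: "complex ^ 'n::finite"
  assumes "v \<noteq> 0"
  shows "function_space SO_star (E1 v) \<and> function_space SO_star (E2 v) \<and>
         eigenfamily SO_star (E1 v) \<and> eigenfamily SO_star (E2 v) \<and>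
         bi_eigenfamily SO_star (E1 v) (E2 v)"
proof -
  let ?u = "vec_join v 0"
  have "bi_eigenfamily SO_star (coeff_space ?u (- 1)) (coeff_space ?u 1)"
    unfolding bi_eigenfamily_def
    using zero_in_coeff_space eigenfamily_coeff_space conformality_coeff_space by blast
  thus ?thesis
    unfolding E1_eq_coeff_space E2_eq_coeff_space
    by (simp add: function_space_coeff_space eigenfamily_coeff_space)
qed

end
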